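(* Let $u,w\in\mathcal{U}$, let $Y$ be any given sequence space, and suppose that the entries of the infinite matrices $A=(a_{nk})$ and $E=(e_{nk})$ are connected by the relation $$e_{nk}=\sum_{j=1}^{n-1}\frac1j\,u_n(w_j-w_{j+1})a_{jk}+\frac1n\,u_nw_na_{nk}\qquad\text{for all }k,n\in\mathbb{N}.$$ Then $A\in(Y:d(bv(u,w)))$ if and only if $E\in(Y:\ell_1)$.
   Context: Indices run over $\mathbb{N}=\{1,2,3,\dots\}$ and $\omega$ is the space of all real (or complex) sequences; a sequence space is a linear subspace of $\omega$. $\mathcal{U}$ is the set of all sequences $u=(u_k)\in\omega$ with $u_k\neq 0$ for all $k$. $\ell_1$ is the space of absolutely summable sequences. For $u,w\in\mathcal{U}$ define the infinite lower triangular matrix $\Sigma=(\sigma_{nk})$ by $\sigma_{nk}=\frac1k u_n(w_k-w_{k+1})$ if $k<n$, $\sigma_{nn}=\frac{u_nw_n}{n}$, $\sigma_{nk}=0$ if $k>n$, and $(\Sigma x)_n=\sum_k\sigma_{nk}x_k$. Define $d(bv(u,w))=\{x\in\omega:\Sigma x\in\ell_1\}$. For sequence spaces $X,Z$ and an infinite matrix $A=(a_{nk})$, $A\in(X:Z)$ means that for every $x\in X$ the series $(Ax)_n=\sum_ka_{nk}x_k$ converges for each $n\in\mathbb{N}$ and the sequence $Ax=((Ax)_n)_n$ belongs to $Z$. *)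

theory Defs
  imports Complex_Main "HOL-Library.Function_Algebras"
begin

text \<open>
  The scalars range over an arbitrary \<^class>\<open>real_normed_field\<close>. The real and the complex numbers
  are instances of this class and, up to isomorphism, the only ones.

  A sequence \<open>(x\<^sub>1, x\<^sub>2, \<dots>)\<close> is represented by a function on \<^typ>\<open>nat\<close> whose value at \<open>k\<close> is
  the term \<open>x\<^sub>k\<^sub>+\<^sub>1\<close>, and likewise for both indices of an infinite matrix. Hence the space of all
  sequences is the whole function type, and a factor \<open>1/k\<close> with \<open>k \<ge> 1\<close> appears as
  \<open>1 / of_nat (Suc k)\<close>.
\<close>

type_synonym 'a matrix = "nat \<Rightarrow> nat \<Rightarrow> 'a"

definition seq_scale :: "'a::real_normed_field \<Rightarrow> (nat \<Rightarrow> 'a) \<Rightarrow> nat \<Rightarrow> 'a" where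
  "seq_scale c x = (\<lambda>k. c * x k)"

lemma vector_space_seq_scale: "vector_space seq_scale"
  by unfold_locales (auto simp: seq_scale_def fun_eq_iff algebra_simps)

definition sequence_space :: "(nat \<Rightarrow> 'a::real_normed_field) set \<Rightarrow> bool" where
  "sequence_space X \<longleftrightarrow> module.subspace seq_scale X"

lemma sequence_space_iff:
  "sequence_space X \<longleftrightarrow>
     (\<lambda>_. 0) \<in> X \<and> (\<forall>x\<in>X. \<forall>y\<in>X. (\<lambda>k. x k + y k) \<in> X) \<and> (\<forall>c. \<forall>x\<in>X. (\<lambda>k. c * x k) \<in> X)"
proof -
  interpret vector_space "seq_scale :: 'a \<Rightarrow> _"
    by (rule vector_space_seq_scale)
  show ?thesis
    by (simp add: sequence_space_def subspace_def seq_scale_def plus_fun_def zero_fun_def)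
qed

definition nonzero_seqs :: "(nat \<Rightarrow> 'a::real_normed_field) set" where
  "nonzero_seqs = {u. \<forall>k. u k \<noteq> 0}"

definition ell1 :: "(nat \<Rightarrow> 'a::real_normed_field) set" where
  "ell1 = {x. summable (\<lambda>n. norm (x n))}"

definition mat_transform :: "'a::real_normed_field matrix \<Rightarrow> (nat \<Rightarrow> 'a) \<Rightarrow> nat \<Rightarrow> 'a" where
  "mat_transform A x = (\<lambda>n. \<Sum>k. A n k * x k)"

definition mat_class ::
  "(nat \<Rightarrow> 'a::real_normed_field) set \<Rightarrow> (nat \<Rightarrow> 'a) set \<Rightarrow> 'a matrix set" where
  "mat_class X Z =
     {A. \<forall>x\<in>X. (\<forall>n. summable (\<lambda>k. A n k * x k)) \<and> mat_transform A x \<in> Z}"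

definition Sigma_mat ::
  "(nat \<Rightarrow> 'a::real_normed_field) \<Rightarrow> (nat \<Rightarrow> 'a) \<Rightarrow> 'a matrix" where
  "Sigma_mat u w n k =
     (if k < n then 1 / of_nat (Suc k) * u n * (w k - w (Suc k))
      else if k = n then u n * w n / of_nat (Suc n)
      else 0)"

text \<open>Every row of \<^const>\<open>Sigma_mat\<close> has finite support, so the series in \<^const>\<open>mat_transform\<close>
  converges here for every \<open>x\<close>.\<close>

definition d_bv ::
  "(nat \<Rightarrow> 'a::real_normed_field) \<Rightarrow> (nat \<Rightarrow> 'a) \<Rightarrow> (nat \<Rightarrow> 'a) set" where
  "d_bv u w = {x. mat_transform (Sigma_mat u w) x \<in> ell1}"

end

theory Submission imports Defs begin

text \<open>
  The hypothesis says \<open>E = \<Sigma>A\<close>. Since \<open>\<Sigma>\<close> is lower triangular, \<open>(Ex)\<^sub>n\<close> is a finite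
  combination of \<open>(Ax)\<^sub>0, \<dots>, (Ax)\<^sub>n\<close>, so \<open>Ex = \<Sigma>(Ax)\<close> as soon as the rows of \<open>A\<close> act
  convergently on \<open>x\<close>. Since the diagonal of \<open>\<Sigma>\<close> vanishes nowhere, the relation can be
  solved for the rows of \<open>A\<close> recursively, so convergence of all \<open>(Ex)\<^sub>n\<close> gives that of all
  \<open>(Ax)\<^sub>n\<close>.
\<close>

lemma mat_transform_lower_triangular:
  fixes T :: "'a::real_normed_field matrix"
  assumes "\<And>k. n < k \<Longrightarrow> T n k = 0"
  shows "mat_transform T x n = (\<Sum>k\<le>n. T n k * x k)"
  unfolding mat_transform_def by (rule suminf_finite) (auto simp: assms)

context
  fixes T A E :: "'a::real_normed_field matrix"
  assumes lower: "\<And>n k. n < k \<Longrightarrow> T n k = 0"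
    and E: "\<And>n k. E n k = (\<Sum>j\<le>n. T n j * A j k)"
begin

text \<open>With \<open>c = x k\<close>, term \<open>k\<close> of the series for row
  \<open>n\<close> of \<open>E\<close> is a fixed finite combination of the terms \<open>k\<close>
  for rows \<open>j \<le> n\<close> of \<open>A\<close>.\<close>

lemma triangular_mult_row:
  "E n k * c = (\<Sum>j\<le>n. T n j * (A j k * c))"
  by (simp add: E sum_distrib_right mult.assoc)

lemma summable_rows_triangular_mult:
  assumes "\<And>n. summable (\<lambda>k. A n k * x k)"
  shows "summable (\<lambda>k. E n k * x k)"
  unfolding triangular_mult_row by (intro summable_sum summable_mult assms)

lemma summable_rows_of_triangular_mult:
  assumes diag: "\<And>n. T n n \<noteq> 0"
    and sums: "\<And>n. summable (\<lambda>k. E n k * x k)"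
  shows "summable (\<lambda>k. A n k * x k)"
proof (induction n rule: less_induct)
  case (less n)
  \<comment> \<open>The summand \<open>j = n\<close> is isolated; the induction hypothesis covers
    the rows \<open>j < n\<close>.\<close>
  have "A n k * x k = (E n k * x k - (\<Sum>j<n. T n j * (A j k * x k))) / T n n" for k
    by (simp add: triangular_mult_row lessThan_Suc_atMost[symmetric] diag)
  moreover have "summable (\<lambda>k. (E n k * x k - (\<Sum>j<n. T n j * (A j k * x k))) / T n n)"
    by (intro summable_divide summable_diff summable_sum summable_mult sums) (simp add: less)
  ultimately show ?case
    by simp
qed

lemma mat_transform_triangular_mult:
  assumes "\<And>n. summable (\<lambda>k. A n k * x k)"
  shows "mat_transform E x = mat_transform T (mat_transform A x)"
proof
  fix n
  have "mat_transform E x n = (\<Sum>k. \<Sum>j\<le>n. T n j * (A j k * x k))"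
    unfolding mat_transform_def triangular_mult_row ..
  \<comment> \<open>Swapping a finite sum with a series is legitimate because each row series of
    \<open>A\<close> converges.\<close>
  also have "\<dots> = (\<Sum>j\<le>n. \<Sum>k. T n j * (A j k * x k))"
    by (intro suminf_sum summable_mult assms)
  also have "\<dots> = (\<Sum>j\<le>n. T n j * mat_transform A x j)"
    unfolding mat_transform_def by (intro sum.cong refl suminf_mult assms)
  also have "\<dots> = mat_transform T (mat_transform A x) n"
    by (rule mat_transform_lower_triangular[symmetric]) (rule lower)
  finally show "mat_transform E x n = mat_transform T (mat_transform A x) n" .
qed

text \<open>For each \<open>x\<close> the two convergence conditions are equivalent, and under them
  both membership conditions concern the same sequence.\<close>

lemma mat_class_triangular_domain_iff:
  assumes "\<And>n. T n n \<noteq> 0"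
  shows "A \<in> mat_class Y {x. mat_transform T x \<in> Z} \<longleftrightarrow> E \<in> mat_class Y Z"
proof -
  have "(\<forall>n. summable (\<lambda>k. A n k * x k)) \<longleftrightarrow> (\<forall>n. summable (\<lambda>k. E n k * x k))" for x
    using summable_rows_triangular_mult summable_rows_of_triangular_mult assms by blast
  then show ?thesis
    unfolding mat_class_def mem_Collect_eq by (metis mat_transform_triangular_mult)
qed

end

theorem theorem4p4:
  fixes u w :: "nat \<Rightarrow> 'a::real_normed_field"
    and Y :: "(nat \<Rightarrow> 'a) set"
    and A E :: "'a matrix"
  assumes "u \<in> nonzero_seqs" and "w \<in> nonzero_seqs"
    and "sequence_space Y"
    and "\<And>n k. E n k =
           (\<Sum>j<n. 1 / of_nat (Suc j) * u n * (w j - w (Suc j)) * A j k)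
           + 1 / of_nat (Suc n) * u n * w n * A n k"
  shows "A \<in> mat_class Y (d_bv u w) \<longleftrightarrow> E \<in> mat_class Y ell1"
  unfolding d_bv_def
proof (rule mat_class_triangular_domain_iff)
  show "Sigma_mat u w n k = 0" if "n < k" for n k
    using that by (simp add: Sigma_mat_def)
  show "E n k = (\<Sum>j\<le>n. Sigma_mat u w n j * A j k)" for n k
    by (simp add: assms(4) Sigma_mat_def lessThan_Suc_atMost[symmetric] del: of_nat_Suc)
  show "Sigma_mat u w n n \<noteq> 0" for n
    \<comment> \<open>Keeping \<open>of_nat (Suc n)\<close> folded lets characteristic zero show the
      denominator nonzero.\<close>
    using assms(1,2) by (simp add: Sigma_mat_def nonzero_seqs_def del: of_nat_Suc)
qed

end
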